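(* Let $G_1$ and $G_2$ be finite simple connected graphs, let $Y$ be a nonempty graph which is a full subgraph of both $G_1$ and $G_2$, and let $G = G_1\cup_Y G_2$. For $i=1,2$ write the Laplacian in block form $$L(G_i)=\begin{bmatrix} A_i & B_i\\ B_i^{T} & D_i\end{bmatrix},$$ where the first block corresponds to $V(G_i)\setminus V(Y)$ and the second to $V(Y)$. Then $${\det}'(L(G)) = \frac{|V(G)|}{|V(Y)|}\,\det(A_1)\,\det(A_2)\,{\det}'\big(\mathrm{DN}(G_1,Y,G_2)\big),$$ where $\mathrm{DN}(G_1,Y,G_2)=\mathrm{DN}(G_1,Y)+\mathrm{DN}(G_2,Y)-L(Y)$.
   Context: For a square matrix $M$, the pseudo-determinant ${\det}'(M)$ is the product of the non-zero eigenvalues of $M$ (with multiplicity; an empty product is $1$, and the determinant of an empty matrix is $1$). A subgraph $Y$ of a graph $H$ is full if $u,v\in V(Y)$ and $\{u,v\}\in E(H)$ imply $\{u,v\}\in E(Y)$. If $Y$ is a full subgraph of $G_1$ and of $G_2$, then $G_1\cup_Y G_2$ is the graph obtained from the disjoint union of $G_1$ and $G_2$ by identifying the two copies of each vertex of $Y$ and the two copies of each edge of $Y$. $L(H)$ is the graph Laplacian: $L(H)(u,u)$ is the degree of $u$ in $H$, $L(H)(u,v)=-1$ if $\{u,v\}\in E(H)$, and $L(H)(u,v)=0$ otherwise. Dirichlet-to-Neumann map: for a finite simple connected graph $H$ and a nonempty full subgraph $Y$ of $H$, write $L(H)=\begin{bmatrix} A & B\\ B^T & D\end{bmatrix}$ with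 $A$ indexed by $V(H)\setminus V(Y)$ and $D$ by $V(Y)$. Then $A$ is invertible and $\mathrm{DN}(H,Y)=D-B^TA^{-1}B$, a matrix indexed by $V(Y)$. *)

theory Defs
  imports
    "Graph_Theory.Graph_Theory"
    "Jordan_Normal_Form.Char_Poly"
    "Jordan_Normal_Form.Gauss_Jordan_Elimination"
begin

text \<open>
  A finite simple graph is a \<open>pair_graph\<close>: a finite, loop-free, symmetric digraph whose arcs are
  pairs of vertices, so that an undirected edge is represented by its two orientations.
  A full subgraph is an \<open>induced_subgraph\<close>.

  A matrix indexed by a finite set of vertices is rendered as a \<open>mat\<close> relative to a
  list enumerating that set without repetition.
\<close>

definition laplacian_entry :: "'v pair_pre_digraph \<Rightarrow> 'v \<Rightarrow> 'v \<Rightarrow> real" where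
  "laplacian_entry H u v =
     (if u = v then real (out_degree (with_proj H) u)
      else if (u, v) \<in> parcs H then - 1
      else 0)"

definition laplacian :: "'v pair_pre_digraph \<Rightarrow> 'v list \<Rightarrow> real mat" where
  "laplacian H vs =
     mat (length vs) (length vs) (\<lambda>(i, j). laplacian_entry H (vs ! i) (vs ! j))"

text \<open>
  The eigenvalues are taken in the complex numbers; the multiplicity of an eigenvalue is its
  algebraic multiplicity.
\<close>

definition pseudo_det :: "real mat \<Rightarrow> complex" where
  "pseudo_det M =
     (let C = map_mat complex_of_real M
      in \<Prod>z \<in> {z. eigenvalue C z \<and> z \<noteq> 0}. z ^ order z (char_poly C))"

text \<open>
  The Dirichlet-to-Neumann matrix of \<open>H\<close> relative to \<open>Y\<close>, where \<open>xs\<close> enumerates the vertices of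
  \<open>H\<close> outside \<open>Y\<close> and \<open>ys\<close> enumerates the vertices of \<open>Y\<close>. The lower left block, ignored here, is
  the transpose of \<open>B\<close>. The value of \<open>the (mat_inverse A)\<close> is unspecified if \<open>A\<close> is singular,
  which does not happen for connected \<open>H\<close> and nonempty \<open>Y\<close>.
\<close>

definition DN :: "'v pair_pre_digraph \<Rightarrow> 'v list \<Rightarrow> 'v list \<Rightarrow> real mat" where
  "DN H xs ys =
     (let (A, B, _, D) = split_block (laplacian H (xs @ ys)) (length xs) (length xs)
      in D - transpose_mat B * the (mat_inverse A) * B)"

definition DN_glued ::
  "'v pair_pre_digraph \<Rightarrow> 'v list \<Rightarrow> 'v pair_pre_digraph \<Rightarrow> 'v list \<Rightarrow> 'v pair_pre_digraph \<Rightarrow> 'v list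
     \<Rightarrow> real mat" where
  "DN_glued G1 xs1 Y ys G2 xs2 = DN G1 xs1 ys + DN G2 xs2 ys - laplacian Y ys"

text \<open>
  Gluing along \<open>Y\<close>: the vertices of the disjoint union of \<open>G1\<close> and \<open>G2\<close> are \<open>Inl u\<close> and \<open>Inr v\<close>;
  the glued graph is its quotient by the equivalence relation identifying \<open>Inl y\<close> with \<open>Inr y\<close>
  for the vertices \<open>y\<close> of \<open>Y\<close>. Thus vertices outside \<open>Y\<close> are kept apart
  even if they belong to both \<open>G1\<close> and \<open>G2\<close>, and the two copies of an edge of \<open>Y\<close> have the same
  image.
\<close>

definition glue_class :: "'v pair_pre_digraph \<Rightarrow> 'v + 'v \<Rightarrow> ('v + 'v) set" where
  "glue_class Y p = {q. q = p \<or> (\<exists>y \<in> pverts Y. {p, q} = {Inl y, Inr y})}"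

definition glue ::
  "'v pair_pre_digraph \<Rightarrow> 'v pair_pre_digraph \<Rightarrow> 'v pair_pre_digraph
     \<Rightarrow> ('v + 'v) set pair_pre_digraph" where
  "glue G1 Y G2 =
     \<lparr> pverts = glue_class Y ` (pverts G1 <+> pverts G2),
       parcs = (\<lambda>(u, v). (glue_class Y (Inl u), glue_class Y (Inl v))) ` parcs G1
             \<union> (\<lambda>(u, v). (glue_class Y (Inr u), glue_class Y (Inr v))) ` parcs G2 \<rparr>"

end

theory Submission
  imports Defs
begin

text \<open>
  Let \<open>M\<close> be an \<open>n \<times> n\<close> matrix whose rows and columns all sum to zero. Adding all columns of
  \<open>x I - M\<close> to the last one turns that column into \<open>x\<close> times the all-ones vector, so \<open>x\<close> splits
  off from the characteristic polynomial; adding all rows to the last one then shows that the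
  cofactor takes the value \<open>\<plusminus> n \<kappa>\<close> at \<open>x = 0\<close>, where \<open>\<kappa>\<close> is the principal minor of \<open>M\<close> that omits
  the last index. If \<open>\<kappa> \<noteq> 0\<close>, then zero is a simple eigenvalue and the product of the
  other eigenvalues is \<open>n \<kappa>\<close> (lemma \<open>pseudo_det_zero_line_sums\<close>). This is the linear algebra behind
  the matrix-tree theorem.

  The identity is applied to two matrices: to \<open>L(G)\<close>, with the vertices of \<open>Y\<close> enumerated last,
  and to the Schur complement of the interior block \<open>A\<close> in \<open>L(G)\<close>. The Schur complement is
  again symmetric with zero row sums, and its size is \<open>|V(Y)|\<close>. The minors \<open>\<kappa>\<close> of the two matrices
  omit the same vertex of \<open>Y\<close>, so block elimination shows that they differ by the factor \<open>det A\<close>.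
  Dividing the two instances yields \<open>det' L(G) = |V(G)| / |V(Y)| * det A * det' S\<close> (lemma
  \<open>pseudo_det_schur_complement\<close>).

  It remains to identify the data of the glued graph. No edge joins \<open>V(G1) - V(Y)\<close> to
  \<open>V(G2) - V(Y)\<close>, so \<open>A\<close> is block diagonal with blocks \<open>A1\<close> and \<open>A2\<close>, and the correction terms of the
  two Dirichlet-to-Neumann maps add up. On \<open>Y\<close> the edges of \<open>Y\<close> belong to both graphs but occur once
  in \<open>G\<close>, so the block of \<open>L(G)\<close> is \<open>D1 + D2 - L(Y)\<close>. Hence \<open>S\<close> is \<open>DN(G1, Y, G2)\<close> (lemma
  \<open>laplacian_glue_blocks\<close>).

  Connectedness enters through the maximum principle: a function that vanishes at some vertex and is
  harmonic wherever it does not vanish is zero. Hence the Laplacian of a connected graph restricted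
  to a proper subset of the vertices is nonsingular (lemma \<open>det_dirichlet_laplacian_nonzero\<close>). This
  covers \<open>A1\<close>, \<open>A2\<close> and, for the subset that omits one vertex, the minor \<open>\<kappa>\<close> of \<open>L(G)\<close>.
\<close>

section \<open>Matrices with zero row and column sums\<close>

text \<open>
  Adding this matrix to a matrix with zero row sums leaves, as determinant, the principal minor
  that omits the last index. Unlike the minor itself, the sum keeps the size of the matrix, so
  it can be formed inside a block decomposition.
\<close>

definition corner_mat :: "nat \<Rightarrow> 'a::zero_neq_one mat" where
  "corner_mat n = mat n n (\<lambda>(i, j). if Suc i = n \<and> Suc j = n then 1 else 0)"

lemma corner_mat_carrier [simp]:
  "corner_mat n \<in> carrier_mat n n" "dim_row (corner_mat n) = n" "dim_col (corner_mat n) = n"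
  by (simp_all add: corner_mat_def)

text \<open>
  The replacement is right multiplication by the unitriangular matrix \<open>C\<close> that adds
  every column to the last one.
\<close>

lemma det_last_col_row_sums:
  fixes M :: "'a::idom mat"
  assumes M: "M \<in> carrier_mat (Suc m) (Suc m)"
  shows "det M = det (mat (Suc m) (Suc m)
           (\<lambda>(i, j). if j = m then \<Sum>k<Suc m. M $$ (i, k) else M $$ (i, j)))" (is "_ = det ?N")
proof -
  define C :: "'a mat" where
    "C = mat (Suc m) (Suc m) (\<lambda>(i, j). if i = j \<or> j = m then 1 else 0)"
  have C: "C \<in> carrier_mat (Suc m) (Suc m)" by (simp add: C_def)
  \<comment> \<open>\<open>C\<close> is unitriangular because the distinguished column is the last one.\<close>
  have "upper_triangular C" by (auto simp: C_def upper_triangular_def)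
  moreover have "diag_mat C = replicate (Suc m) 1"
    by (rule nth_equalityI) (auto simp: C_def diag_mat_def simp del: upt_Suc replicate_Suc)
  ultimately have "det C = 1" by (simp add: det_upper_triangular[OF _ C])
  moreover have "M * C = ?N"
  proof (rule eq_matI)
    fix i j assume "i < dim_row ?N" "j < dim_col ?N"
    then have ij: "i < Suc m" "j < Suc m" by auto
    have "(M * C) $$ (i, j) = (\<Sum>k<Suc m. M $$ (i, k) * (if k = j \<or> j = m then 1 else 0))"
      using M ij by (auto simp: scalar_prod_def C_def lessThan_atLeast0 simp del: sum.op_ivl_Suc
          intro!: sum.cong)
    also have "\<dots> = ?N $$ (i, j)"
    proof (cases "j = m")
      case False
      then have "(\<Sum>k<Suc m. M $$ (i, k) * (if k = j \<or> j = m then 1 else 0))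
          = (\<Sum>k<Suc m. if k = j then M $$ (i, k) else 0)" by (intro sum.cong) auto
      also have "\<dots> = M $$ (i, j)" using ij by (subst sum.delta) auto
      finally show ?thesis using False ij by simp
    qed (use ij in simp)
    finally show "(M * C) $$ (i, j) = ?N $$ (i, j)" .
  qed (use M in \<open>auto simp: C_def\<close>)
  ultimately show ?thesis using det_mult[OF M C] by simp
qed

lemma det_last_row_col_sums:
  fixes M :: "'a::idom mat"
  assumes M: "M \<in> carrier_mat (Suc m) (Suc m)"
  shows "det M = det (mat (Suc m) (Suc m)
           (\<lambda>(i, j). if i = m then \<Sum>k<Suc m. M $$ (k, j) else M $$ (i, j)))" (is "_ = det ?N")
proof -
  have "det M = det (transpose_mat M)" by (simp add: det_transpose[OF M])
  also have "\<dots> = det (transpose_mat ?N)"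
    by (subst det_last_col_row_sums[of _ m])
      (use M in \<open>auto intro!: arg_cong[where f = det] eq_matI sum.cong simp del: sum.lessThan_Suc\<close>)
  also have "\<dots> = det ?N" by (rule det_transpose[of _ "Suc m"]) simp
  finally show ?thesis .
qed

lemma det_last_col_unit:
  fixes N :: "'a::idom mat"
  assumes N: "N \<in> carrier_mat (Suc m) (Suc m)" and "\<And>i. i < m \<Longrightarrow> N $$ (i, m) = 0"
  shows "det N = det (mat m m (\<lambda>p. N $$ p)) * N $$ (m, m)"
proof -
  have "N = four_block_mat (mat m m (\<lambda>p. N $$ p)) (0\<^sub>m m 1)
      (mat 1 m (\<lambda>(_, j). N $$ (m, j))) (mat 1 1 (\<lambda>_. N $$ (m, m)))"
    by (rule eq_matI) (use assms in \<open>auto simp: less_Suc_eq\<close>)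
  then have "det N = det (mat m m (\<lambda>p. N $$ p)) * det (mat 1 1 (\<lambda>_. N $$ (m, m)))"
    by (metis det_four_block_mat_upper_right_zero mat_carrier)
  also have "det (mat 1 1 (\<lambda>_. N $$ (m, m))) = N $$ (m, m)"
    by (subst det_single) auto
  finally show ?thesis .
qed

lemma det_last_row_unit:
  fixes N :: "'a::idom mat"
  assumes N: "N \<in> carrier_mat (Suc m) (Suc m)" and "\<And>j. j < m \<Longrightarrow> N $$ (m, j) = 0"
  shows "det N = det (mat m m (\<lambda>p. N $$ p)) * N $$ (m, m)"
proof -
  have "det N = det (transpose_mat N)" by (simp add: det_transpose[OF N])
  also have "\<dots> = det (mat m m (\<lambda>p. transpose_mat N $$ p)) * N $$ (m, m)"
    by (subst det_last_col_unit[of _ m]) (use assms in auto)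
  also have "mat m m (\<lambda>p. transpose_mat N $$ p) = transpose_mat (mat m m (\<lambda>p. N $$ p))"
    by (rule eq_matI) (use N in auto)
  also have "det \<dots> = det (mat m m (\<lambda>p. N $$ p))" by (rule det_transpose[of _ m]) simp
  finally show ?thesis .
qed

text \<open>
  The corner entry makes the last row sum equal to one while the others stay zero. Replacing the
  last column by the row sums therefore turns it into the last unit vector, and expansion along
  it leaves the minor.
\<close>

lemma det_add_corner_mat:
  fixes M :: "'a::idom mat"
  assumes M: "M \<in> carrier_mat (Suc m) (Suc m)"
    and rows: "\<And>i. i < Suc m \<Longrightarrow> (\<Sum>j<Suc m. M $$ (i, j)) = 0"
  shows "det (M + corner_mat (Suc m)) = det (mat m m (\<lambda>p. M $$ p))"
proof -
  define N where "N = M + corner_mat (Suc m)"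
  let ?N' = "mat (Suc m) (Suc m)
           (\<lambda>(i, j). if j = m then \<Sum>k<Suc m. N $$ (i, k) else N $$ (i, j))"
  have sums: "(\<Sum>k<Suc m. N $$ (i, k)) = (if i = m then 1 else 0)" if i: "i < Suc m" for i
  proof -
    have "(\<Sum>k<Suc m. N $$ (i, k))
        = (\<Sum>k<Suc m. M $$ (i, k) + (if k = m then if i = m then 1 else 0 else 0))"
      using M i by (intro sum.cong) (auto simp: N_def corner_mat_def)
    also have "\<dots> = (if i = m then 1 else 0)"
      unfolding sum.distrib rows[OF i] by (subst sum.delta) auto
    finally show ?thesis .
  qed
  have "det N = det ?N'"
    by (rule det_last_col_row_sums) (use M in \<open>simp add: N_def\<close>)
  also have "\<dots> = det (mat m m (\<lambda>p. ?N' $$ p)) * ?N' $$ (m, m)"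
    by (rule det_last_col_unit) (auto simp: sums simp del: sum.lessThan_Suc)
  also have "?N' $$ (m, m) = 1" by (simp add: sums del: sum.lessThan_Suc)
  also have "mat m m (\<lambda>p. ?N' $$ p) = mat m m (\<lambda>p. M $$ p)"
    by (rule eq_matI) (use M in \<open>auto simp: N_def corner_mat_def\<close>)
  finally show ?thesis by (simp add: N_def)
qed

text \<open>
  All rows of \<open>x I - M\<close> sum to \<open>x\<close>, so replacing the last column by
  the row sums produces a factor \<open>x\<close>. At \<open>x = 0\<close> the remaining
  determinant is that of \<open>- M\<close> with the last column all ones; its column sums are
  \<open>0, \<dots>, 0, n\<close>, and replacing the last row by them leaves \<open>n\<close>
  times a principal minor of \<open>- M\<close>.
\<close>

lemma char_poly_zero_line_sums:
  fixes M :: "'a::idom mat"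
  assumes M: "M \<in> carrier_mat (Suc m) (Suc m)"
    and rows: "\<And>i. i < Suc m \<Longrightarrow> (\<Sum>j<Suc m. M $$ (i, j)) = 0"
    and cols: "\<And>j. j < Suc m \<Longrightarrow> (\<Sum>i<Suc m. M $$ (i, j)) = 0"
  obtains q where "char_poly M = [:0, 1:] * q"
    and "poly q 0 = (- 1) ^ m * of_nat (Suc m) * det (M + corner_mat (Suc m))"
proof -
  let ?n = "Suc m"
  let ?R = "char_poly_matrix M"
  define R' where "R' = mat ?n ?n (\<lambda>(i, j). if j = m then 1 else ?R $$ (i, j))"
  \<comment> \<open>\<open>D\<close> carries the factor \<open>x\<close> of the last column.\<close>
  define D :: "'a poly mat" where
    "D = mat ?n ?n (\<lambda>(i, j). if i \<noteq> j then 0 else if j = m then [:0, 1:] else 1)"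
  have R: "?R \<in> carrier_mat ?n ?n" and R': "R' \<in> carrier_mat ?n ?n" and D: "D \<in> carrier_mat ?n ?n"
    using M by (auto simp: R'_def D_def)
  have entry: "?R $$ (i, j) = (if i = j then [:0, 1:] else 0) - [:M $$ (i, j):]"
    if "i < ?n" "j < ?n" for i j
    using that M by (auto simp: char_poly_matrix_def)
  have sums: "(\<Sum>k<?n. ?R $$ (i, k)) = [:0, 1:]" if i: "i < ?n" for i
  proof -
    have "(\<Sum>k<?n. ?R $$ (i, k)) = (\<Sum>k<?n. (if k = i then [:0, 1:] else 0) - [:M $$ (i, k):])"
      using i by (intro sum.cong) (auto simp: entry)
    also have "\<dots> = [:0, 1:] - (\<Sum>k<?n. [:M $$ (i, k):])"
      unfolding sum_subtractf using i by (subst sum.delta) auto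
    also have "(\<Sum>k<?n. [:M $$ (i, k):]) = [:\<Sum>k<?n. M $$ (i, k):]"
      by (induction ("?n")) auto
    finally show ?thesis using rows[OF i] by (simp del: sum.lessThan_Suc)
  qed
  have "char_poly M = det (mat ?n ?n
           (\<lambda>(i, j). if j = m then \<Sum>k<?n. ?R $$ (i, k) else ?R $$ (i, j)))"
    unfolding char_poly_def by (rule det_last_col_row_sums[OF R])
  also have "\<dots> = det (R' * D)"
  proof (rule arg_cong[where f = det], rule sym, rule eq_matI, goal_cases)
    case (1 i j)
    then have ij: "i < ?n" "j < ?n" by auto
    have "(R' * D) $$ (i, j) = (\<Sum>k<?n. R' $$ (i, k) * D $$ (k, j))"
      using R' D ij by (simp add: scalar_prod_def lessThan_atLeast0 del: sum.op_ivl_Suc)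
    also have "\<dots> = (\<Sum>k<?n. if k = j then R' $$ (i, j) * D $$ (j, j) else 0)"
      using ij by (intro sum.cong) (auto simp: D_def)
    also have "\<dots> = R' $$ (i, j) * D $$ (j, j)" using ij by (subst sum.delta) auto
    finally show ?case using ij by (auto simp: R'_def D_def sums simp del: sum.lessThan_Suc)
  qed (use R' D in auto)
  also have "\<dots> = det R' * det D" by (rule det_mult[OF R' D])
  also have "det D = [:0, 1:]"
  proof -
    have "det D = det (mat m m (\<lambda>p. D $$ p)) * D $$ (m, m)"
      by (rule det_last_col_unit[OF D]) (auto simp: D_def)
    also have "mat m m (\<lambda>p. D $$ p) = 1\<^sub>m m" by (rule eq_matI) (auto simp: D_def)
    finally show ?thesis by (simp add: D_def)
  qed
  finally have char: "char_poly M = [:0, 1:] * det R'" by (simp add: mult.commute)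
  \<comment> \<open>\<open>Q\<close> is \<open>R'\<close> evaluated at \<open>x = 0\<close>.\<close>
  define Q where "Q = mat ?n ?n (\<lambda>(i, j). if j = m then 1 else - (M $$ (i, j)))"
  define Q' where "Q' = mat ?n ?n (\<lambda>(i, j). if i = m then \<Sum>k<?n. Q $$ (k, j) else Q $$ (i, j))"
  have Q: "Q \<in> carrier_mat ?n ?n" and Q': "Q' \<in> carrier_mat ?n ?n" by (auto simp: Q_def Q'_def)
  have Qsums: "(\<Sum>k<?n. Q $$ (k, j)) = (if j = m then of_nat ?n else 0)" if j: "j < ?n" for j
  proof (cases "j = m")
    case True
    then have "(\<Sum>k<?n. Q $$ (k, j)) = (\<Sum>k<?n. 1)" by (intro sum.cong) (auto simp: Q_def)
    then show ?thesis using True by simp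
  next
    case False
    then have "(\<Sum>k<?n. Q $$ (k, j)) = (\<Sum>k<?n. - M $$ (k, j))"
      using j by (intro sum.cong) (auto simp: Q_def)
    then show ?thesis using False cols[OF j] by (simp add: sum_negf del: sum.lessThan_Suc)
  qed
  have "poly (det R') 0 = det Q"
    by (rule poly_det_cong[OF Q R']) (auto simp: R'_def Q_def entry)
  also have "\<dots> = det Q'" unfolding Q'_def by (rule det_last_row_col_sums[OF Q])
  also have "\<dots> = det (mat m m (\<lambda>p. Q' $$ p)) * Q' $$ (m, m)"
    by (rule det_last_row_unit[OF Q']) (auto simp: Q'_def Qsums simp del: sum.lessThan_Suc)
  also have "Q' $$ (m, m) = of_nat ?n" by (simp add: Q'_def Qsums del: sum.lessThan_Suc)
  also have "mat m m (\<lambda>p. Q' $$ p) = (- 1) \<cdot>\<^sub>m mat m m (\<lambda>p. M $$ p)"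
    by (rule eq_matI) (auto simp: Q'_def Q_def)
  also have "det \<dots> = (- 1) ^ m * det (M + corner_mat ?n)"
    by (simp add: det_add_corner_mat[OF M rows])
  finally have "poly (det R') 0 = (- 1) ^ m * of_nat ?n * det (M + corner_mat ?n)"
    by (simp add: mult_ac)
  with char show thesis by (rule that)
qed

text \<open>
  The pseudo-determinant depends on the characteristic polynomial only. This makes it invariant
  under reordering of the vertices.
\<close>

lemma pseudo_det_char_poly:
  assumes M: "M \<in> carrier_mat n n"
  shows "pseudo_det M =
    (let p = map_poly complex_of_real (char_poly M)
      in \<Prod>z \<in> {z. poly p z = 0 \<and> z \<noteq> 0}. z ^ order z p)"
proof -
  have C: "map_mat complex_of_real M \<in> carrier_mat n n" using M by simp
  show ?thesis
    unfolding pseudo_det_def Let_def eigenvalue_root_char_poly[OF C]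
      of_real_hom.char_poly_hom[OF M] ..
qed

lemma pseudo_det_similar:
  assumes "similar_mat M N" shows "pseudo_det M = pseudo_det N"
proof -
  obtain n where M: "M \<in> carrier_mat n n" and N: "N \<in> carrier_mat n n"
    using similar_matD[OF assms] by blast
  show ?thesis
    unfolding pseudo_det_char_poly[OF M] pseudo_det_char_poly[OF N] char_poly_similar[OF assms] ..
qed

text \<open>
  Since zero is not a root of \<open>q\<close>, the nonzero roots of \<open>x q\<close> are
  exactly the roots of \<open>q\<close>, with the same multiplicities. Evaluating the
  factorisation of \<open>q\<close> at zero gives their product up to a sign for each root.
\<close>

lemma prod_nonzero_roots:
  fixes q :: "complex poly"
  assumes monic: "lead_coeff q = 1" and q0: "poly q 0 \<noteq> 0"
  shows "(\<Prod>z \<in> {z. poly ([:0, 1:] * q) z = 0 \<and> z \<noteq> 0}. z ^ order z ([:0, 1:] * q))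
    = (- 1) ^ degree q * poly q 0"
proof -
  have nz: "q \<noteq> 0" using q0 by auto
  let ?Z = "{z. poly q z = 0}"
  have fin: "finite ?Z" using nz by (rule poly_roots_finite)
  have Z: "{z. poly ([:0, 1:] * q) z = 0 \<and> z \<noteq> 0} = ?Z" using q0 by auto
  have ord: "order z ([:0, 1:] * q) = order z q" if "z \<in> ?Z" for z
  proof -
    have "poly [:0, 1:] z \<noteq> 0" using that q0 by auto
    then have "order z [:0, 1:] = 0" by (rule order_0I)
    then show ?thesis using nz by (subst order_mult) auto
  qed
  have decomp: "(\<Prod>z\<in>?Z. [:- z, 1:] ^ order z q) = q"
    using complex_poly_decompose[of q] monic by simp
  have "degree q = degree (\<Prod>z\<in>?Z. [:- z, 1:] ^ order z q)" by (simp add: decomp)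
  also have "\<dots> = (\<Sum>z\<in>?Z. order z q)"
    by (subst degree_prod_eq_sum_degree) (auto simp: degree_power_eq)
  finally have deg: "degree q = (\<Sum>z\<in>?Z. order z q)" .
  have "poly q 0 = poly (\<Prod>z\<in>?Z. [:- z, 1:] ^ order z q) 0" by (simp add: decomp)
  also have "\<dots> = (\<Prod>z\<in>?Z. (- 1) ^ order z q * z ^ order z q)"
    by (simp add: poly_prod poly_power power_mult_distrib[symmetric])
  also have "\<dots> = (- 1) ^ degree q * (\<Prod>z\<in>?Z. z ^ order z q)"
    by (simp add: prod.distrib deg power_sum)
  finally have "(\<Prod>z\<in>?Z. z ^ order z q) = (- 1) ^ degree q * poly q 0"
    by (simp add: mult.assoc[symmetric] power_mult_distrib[symmetric])
  moreover have "(\<Prod>z\<in>?Z. z ^ order z ([:0, 1:] * q)) = (\<Prod>z\<in>?Z. z ^ order z q)"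
    by (intro prod.cong) (simp_all only: ord)
  ultimately show ?thesis unfolding Z by simp
qed

text \<open>
  The nonvanishing of the minor guarantees that zero is a simple root of the characteristic
  polynomial. If zero were a multiple root, the right-hand side would vanish, whereas a
  pseudo-determinant never does.
\<close>

lemma pseudo_det_zero_line_sums:
  assumes M: "M \<in> carrier_mat n n" and n: "n > 0"
    and rows: "\<And>i. i < n \<Longrightarrow> (\<Sum>j<n. M $$ (i, j)) = 0"
    and cols: "\<And>j. j < n \<Longrightarrow> (\<Sum>i<n. M $$ (i, j)) = 0"
    and nz: "det (M + corner_mat n) \<noteq> 0"
  shows "pseudo_det M = complex_of_real (real n * det (M + corner_mat n))"
proof -
  obtain m where m: "n = Suc m" using n by (cases n) auto
  obtain q where q: "char_poly M = [:0, 1:] * q"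
    and q0: "poly q 0 = (- 1) ^ m * of_nat n * det (M + corner_mat n)"
    using char_poly_zero_line_sums[of M m] M rows cols unfolding m by blast
  have "q \<noteq> 0" using q0 nz n by auto
  then have "degree (char_poly M) = Suc (degree q)"
    unfolding q by (subst degree_mult_eq) auto
  moreover have "lead_coeff (char_poly M) = lead_coeff q"
    unfolding q lead_coeff_mult by simp
  ultimately have deg: "degree q = m" and lead: "lead_coeff q = 1"
    using degree_monic_char_poly[OF M] m by auto
  let ?q = "map_poly complex_of_real q"
  interpret of_real_poly: map_poly_comm_ring_hom complex_of_real ..
  have q': "map_poly complex_of_real (char_poly M) = [:0, 1:] * ?q"
    unfolding q of_real_poly.hom_mult by simp
  have deg': "degree ?q = m" by (simp add: deg)
  have lead': "lead_coeff ?q = 1" using lead by simp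
  have q0': "poly ?q 0 = complex_of_real (poly q 0)"
    using of_real_hom.poly_map_poly[of q 0] by simp
  have "pseudo_det M = (- 1) ^ m * poly ?q 0"
    unfolding pseudo_det_char_poly[OF M] Let_def q'
    using prod_nonzero_roots[OF lead'] q0' q0 nz n deg' by simp
  also have "\<dots> = complex_of_real ((- 1) ^ m * ((- 1) ^ m * of_nat n * det (M + corner_mat n)))"
    unfolding q0' q0 by simp
  also have "(- 1) ^ m * ((- 1) ^ m * of_nat n * det (M + corner_mat n))
      = real n * det (M + corner_mat n)"
    by (simp add: mult.assoc[symmetric] power_mult_distrib[symmetric])
  finally show ?thesis .
qed

section \<open>Schur complements\<close>

text \<open>
  Block elimination: splitting off a block unitriangular factor on the right clears the upper
  right block and leaves \<open>A\<close> and the Schur complement on the diagonal.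
\<close>

lemma det_four_block_mat_schur:
  fixes A :: "'a::idom mat"
  assumes A: "A \<in> carrier_mat n n" and B: "B \<in> carrier_mat n k"
    and C: "C \<in> carrier_mat k n" and D: "D \<in> carrier_mat k k"
    and X: "X \<in> carrier_mat n n" and AX: "A * X = 1\<^sub>m n"
  shows "det (four_block_mat A B C D) = det A * det (D - C * X * B)"
proof -
  let ?S = "D - C * X * B"
  let ?U = "four_block_mat (1\<^sub>m n) (X * B) (0\<^sub>m k n) (1\<^sub>m k)"
  let ?L = "four_block_mat A (0\<^sub>m n k) C ?S"
  have S: "?S \<in> carrier_mat k k" using B C D X by auto
  have "A * (X * B) = B"
    using assoc_mult_mat[OF A X B] AX B by simp
  moreover have "C * (X * B) + ?S = D"
    using assoc_mult_mat[OF C X B] B C D X by (intro eq_matI) auto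
  ultimately have "?L * ?U = four_block_mat A B C D"
    using A B C D X S
    by (subst mult_four_block_mat[of A n n _ k _ k _ _ n _ k]) auto
  then have "det (four_block_mat A B C D) = det (?L * ?U)" by simp
  also have "\<dots> = det ?L * det ?U"
    by (rule det_mult) (use A S in auto)
  also have "det ?U = 1"
    by (subst det_four_block_mat_lower_left_zero[of _ n _ k]) (use X B in auto)
  also have "det ?L = det A * det ?S"
    by (rule det_four_block_mat_upper_right_zero[OF A refl C S])
  finally show ?thesis by simp
qed

lemma mult_ones_index:
  fixes M :: "'a::comm_ring_1 mat"
  assumes "M \<in> carrier_mat n k" "i < n"
  shows "(M *\<^sub>v vec k (\<lambda>_. 1)) $ i = (\<Sum>j<k. M $$ (i, j))"
  using assms by (auto simp: scalar_prod_def lessThan_atLeast0 intro!: sum.cong)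

text \<open>
  If the block matrix annihilates the all-ones vector \<open>(u, w)\<close>, then the first
  block row gives \<open>u = - X B w\<close>, and substituting this into the second block row
  gives \<open>(D - C X B) w = 0\<close>.
\<close>

lemma schur_complement_row_sums:
  fixes A :: "'a::comm_ring_1 mat"
  assumes A: "A \<in> carrier_mat n n" and B: "B \<in> carrier_mat n k"
    and C: "C \<in> carrier_mat k n" and D: "D \<in> carrier_mat k k"
    and X: "X \<in> carrier_mat n n" and XA: "X * A = 1\<^sub>m n"
    and rows: "\<And>i. i < n + k \<Longrightarrow> (\<Sum>j<n + k. four_block_mat A B C D $$ (i, j)) = 0"
    and i: "i < k"
  shows "(\<Sum>j<k. (D - C * X * B) $$ (i, j)) = 0"
proof -
  let ?u = "vec n (\<lambda>_. 1) :: 'a vec" and ?w = "vec k (\<lambda>_. 1) :: 'a vec"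
  have u: "?u \<in> carrier_vec n" and w: "?w \<in> carrier_vec k" by auto
  have "four_block_mat A B C D *\<^sub>v vec (n + k) (\<lambda>_. 1) = 0\<^sub>v (n + k)"
    by (rule eq_vecI) (use A D rows in \<open>auto simp: mult_ones_index[of _ "n + k"] simp del: index_mult_mat_vec index_mat_four_block(1)\<close>)
  moreover have "vec (n + k) (\<lambda>_. 1) = ?u @\<^sub>v ?w" by (rule eq_vecI) auto
  ultimately have "(A *\<^sub>v ?u + B *\<^sub>v ?w) @\<^sub>v (C *\<^sub>v ?u + D *\<^sub>v ?w) = 0\<^sub>v n @\<^sub>v 0\<^sub>v k"
    using four_block_mat_mult_vec[OF A B C D u w] by (auto intro!: eq_vecI)
  then have 1: "A *\<^sub>v ?u + B *\<^sub>v ?w = 0\<^sub>v n" and 2: "C *\<^sub>v ?u + D *\<^sub>v ?w = 0\<^sub>v k"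
    using A B C D append_vec_eq[of "A *\<^sub>v ?u + B *\<^sub>v ?w" n "0\<^sub>v n"] by auto
  have Au: "A *\<^sub>v ?u \<in> carrier_vec n" and Bw: "B *\<^sub>v ?w \<in> carrier_vec n" using A B by auto
  have "0\<^sub>v n = X *\<^sub>v (A *\<^sub>v ?u + B *\<^sub>v ?w)" using X 1 by (auto intro!: eq_vecI)
  also have "\<dots> = X *\<^sub>v (A *\<^sub>v ?u) + X *\<^sub>v (B *\<^sub>v ?w)"
    by (rule mult_add_distrib_mat_vec[OF X Au Bw])
  also have "X *\<^sub>v (A *\<^sub>v ?u) = ?u"
    using assoc_mult_mat_vec[OF X A u] XA by simp
  finally have 3: "?u + X *\<^sub>v (B *\<^sub>v ?w) = 0\<^sub>v n" ..
  have XBw: "X *\<^sub>v (B *\<^sub>v ?w) \<in> carrier_vec n" using X Bw by simp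
  have "0\<^sub>v k = C *\<^sub>v (?u + X *\<^sub>v (B *\<^sub>v ?w))" unfolding 3 using C by (auto intro!: eq_vecI)
  also have "\<dots> = C *\<^sub>v ?u + C *\<^sub>v (X *\<^sub>v (B *\<^sub>v ?w))"
    by (rule mult_add_distrib_mat_vec[OF C u XBw])
  also have "C *\<^sub>v (X *\<^sub>v (B *\<^sub>v ?w)) = (C * X * B) *\<^sub>v ?w"
    using assoc_mult_mat_vec[OF C X Bw] assoc_mult_mat_vec[OF mult_carrier_mat[OF C X] B w] by simp
  finally have 4: "C *\<^sub>v ?u + (C * X * B) *\<^sub>v ?w = 0\<^sub>v k" ..
  have "(D - C * X * B) *\<^sub>v ?w = D *\<^sub>v ?w - (C * X * B) *\<^sub>v ?w"
    by (rule minus_mult_distrib_mat_vec[of _ k k]) (use B C D X in auto)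
  also have "\<dots> $ i = 0"
  proof -
    have "(C *\<^sub>v ?u) $ i + (D *\<^sub>v ?w) $ i = 0"
      using arg_cong[OF 2, of "\<lambda>v. v $ i"] i C D by simp
    moreover have "(C *\<^sub>v ?u) $ i + ((C * X * B) *\<^sub>v ?w) $ i = 0"
      using arg_cong[OF 4, of "\<lambda>v. v $ i"] i B C by simp
    ultimately have "(D *\<^sub>v ?w) $ i = ((C * X * B) *\<^sub>v ?w) $ i"
      by (metis add_left_cancel)
    then show ?thesis using i B C D by simp
  qed
  finally have "((D - C * X * B) *\<^sub>v ?w) $ i = 0" .
  moreover have "D - C * X * B \<in> carrier_mat k k" using B C D X by auto
  ultimately show ?thesis using mult_ones_index[OF _ i] by metis
qed

lemma inverse_symmetric:
  fixes A :: "'a::field mat"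
  assumes A: "A \<in> carrier_mat n n" and X: "X \<in> carrier_mat n n"
    and AX: "A * X = 1\<^sub>m n" and sym: "transpose_mat A = A"
  shows "transpose_mat X = X"
proof -
  have "transpose_mat X * A = 1\<^sub>m n"
    using transpose_mult[OF A X] AX sym by simp
  then have "transpose_mat X * A * X = X" using X by simp
  moreover have "transpose_mat X * A * X = transpose_mat X"
    using assoc_mult_mat[of "transpose_mat X" n n A n X n] A X AX by simp
  ultimately show ?thesis by simp
qed

lemma symmetric_col_sums:
  assumes "M \<in> carrier_mat n n" "transpose_mat M = M"
    and "\<And>i. i < n \<Longrightarrow> (\<Sum>j<n. M $$ (i, j)) = 0" and "j < n"
  shows "(\<Sum>i<n. M $$ (i, j)) = 0"
proof -
  have "(\<Sum>i<n. M $$ (i, j)) = (\<Sum>i<n. transpose_mat M $$ (j, i))"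
    using assms(1,4) by (intro sum.cong) auto
  then show ?thesis using assms(2-4) by simp
qed

text \<open>
  The corner lies in the block \<open>D\<close>, so adding it commutes with taking the Schur
  complement, and the determinants with corner of \<open>M\<close> and of its Schur complement
  \<open>S\<close> differ by the factor \<open>det A\<close>. Each of them is the
  pseudo-determinant divided by the size of the matrix.
\<close>

lemma pseudo_det_schur_complement:
  fixes A :: "real mat"
  assumes A: "A \<in> carrier_mat n n" and B: "B \<in> carrier_mat n k" and D: "D \<in> carrier_mat k k"
    and k: "k > 0" and Asym: "transpose_mat A = A" and Dsym: "transpose_mat D = D"
    and X: "X \<in> carrier_mat n n" and AX: "A * X = 1\<^sub>m n" and XA: "X * A = 1\<^sub>m n"
    and M: "M = four_block_mat A B (transpose_mat B) D"
    and rows: "\<And>i. i < n + k \<Longrightarrow> (\<Sum>j<n + k. M $$ (i, j)) = 0"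
    and nz: "det (M + corner_mat (n + k)) \<noteq> 0"
  shows "pseudo_det M = complex_of_real (real (n + k) / real k * det A)
    * pseudo_det (D - transpose_mat B * X * B)"
proof -
  let ?C = "transpose_mat B"
  let ?S = "D - ?C * X * B"
  have C: "?C \<in> carrier_mat k n" using B by simp
  have Mc: "M \<in> carrier_mat (n + k) (n + k)" using A D M by simp
  have S: "?S \<in> carrier_mat k k" using B X D by auto
  have Msym: "transpose_mat M = M"
    unfolding M transpose_four_block_mat[OF A B C D] using Asym Dsym by simp
  have Ssym: "transpose_mat ?S = ?S"
  proof -
    have CX: "?C * X \<in> carrier_mat k n" using C X by simp
    have "transpose_mat (?C * X * B) = ?C * (X * B)"
      using transpose_mult[OF CX B] transpose_mult[OF C X] inverse_symmetric[OF A X AX Asym] by simp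
    also have "\<dots> = ?C * X * B" using assoc_mult_mat[OF C X B] by simp
    finally have "transpose_mat (?C * X * B) = ?C * X * B" .
    moreover have "transpose_mat ?S = transpose_mat D - transpose_mat (?C * X * B)"
      using B D by (intro eq_matI) auto
    ultimately show ?thesis using Dsym by simp
  qed
  have Srows: "(\<Sum>j<k. ?S $$ (i, j)) = 0" if "i < k" for i
    by (rule schur_complement_row_sums[OF A B C D X XA rows[unfolded M] that])
  have "corner_mat (n + k) = four_block_mat (0\<^sub>m n n) (0\<^sub>m n k) (0\<^sub>m k n) (corner_mat k :: real mat)"
    by (rule eq_matI) (use k in \<open>auto simp: corner_mat_def\<close>)
  then have "M + corner_mat (n + k) = four_block_mat (A + 0\<^sub>m n n) (B + 0\<^sub>m n k)
      (?C + 0\<^sub>m k n) (D + corner_mat k)"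
    unfolding M using add_four_block_mat[OF A B C D] by auto
  also have "\<dots> = four_block_mat A B ?C (D + corner_mat k)" using A B C by simp
  finally have "det (M + corner_mat (n + k)) = det A * det (D + corner_mat k - ?C * X * B)"
    using det_four_block_mat_schur[OF A B C _ X AX, of "D + corner_mat k"] D by simp
  also have "D + corner_mat k - ?C * X * B = ?S + corner_mat k"
    by (rule eq_matI) (use B D in \<open>auto simp del: assoc_mult_mat\<close>)
  finally have det: "det (M + corner_mat (n + k)) = det A * det (?S + corner_mat k)" .
  have "pseudo_det M = complex_of_real (real (n + k) * det (M + corner_mat (n + k)))"
    by (rule pseudo_det_zero_line_sums[OF Mc _ rows symmetric_col_sums[OF Mc Msym rows] nz])
      (use k in auto)
  moreover have "pseudo_det ?S = complex_of_real (real k * det (?S + corner_mat k))"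
    by (rule pseudo_det_zero_line_sums[OF S k Srows symmetric_col_sums[OF S Ssym Srows]])
      (use nz det in auto)
  ultimately show ?thesis using k unfolding det by simp
qed

lemma mat_inverse_det_nonzero:
  fixes A :: "'a::field mat"
  assumes A: "A \<in> carrier_mat n n" and det: "det A \<noteq> 0"
  shows "the (mat_inverse A) \<in> carrier_mat n n"
    and "A * the (mat_inverse A) = 1\<^sub>m n" and "the (mat_inverse A) * A = 1\<^sub>m n"
proof -
  have "A \<in> Units (ring_mat TYPE('a) n ())" by (rule det_non_zero_imp_unit[OF A det])
  then obtain X where "mat_inverse A = Some X" using mat_inverse(1)[OF A, where b = "()"] by (cases "mat_inverse A") auto
  with mat_inverse(2)[OF A this]
  show "the (mat_inverse A) \<in> carrier_mat n n"
    "A * the (mat_inverse A) = 1\<^sub>m n" "the (mat_inverse A) * A = 1\<^sub>m n" by auto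
qed

text \<open>
  The stacked matrix is viewed as a block matrix with two blocks of width zero, to which block
  multiplication applies.
\<close>

lemma block_diagonal_congruence:
  fixes X1 :: "'a::comm_ring_1 mat"
  assumes X1: "X1 \<in> carrier_mat n1 n1" and X2: "X2 \<in> carrier_mat n2 n2"
    and B1: "B1 \<in> carrier_mat n1 k" and B2: "B2 \<in> carrier_mat n2 k"
  shows "transpose_mat (B1 @\<^sub>r B2) * four_block_mat X1 (0\<^sub>m n1 n2) (0\<^sub>m n2 n1) X2 * (B1 @\<^sub>r B2)
    = transpose_mat B1 * X1 * B1 + transpose_mat B2 * X2 * B2" (is "?l = ?r")
proof -
  let ?C1 = "transpose_mat B1" and ?C2 = "transpose_mat B2"
  have C: "?C1 \<in> carrier_mat k n1" "?C2 \<in> carrier_mat k n2" using B1 B2 by auto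
  have B: "B1 @\<^sub>r B2 = four_block_mat B1 (0\<^sub>m n1 0) B2 (0\<^sub>m n2 0)"
    using B1 B2 by (simp add: append_rows_def)
  have T: "transpose_mat (B1 @\<^sub>r B2) = four_block_mat ?C1 ?C2 (0\<^sub>m 0 n1) (0\<^sub>m 0 n2)"
    unfolding B using B1 B2 by (subst transpose_four_block_mat[of _ n1 k _ 0 _ n2]) auto
  have TX: "transpose_mat (B1 @\<^sub>r B2) * four_block_mat X1 (0\<^sub>m n1 n2) (0\<^sub>m n2 n1) X2
    = four_block_mat (?C1 * X1) (?C2 * X2) (0\<^sub>m 0 n1) (0\<^sub>m 0 n2)"
    unfolding T using C X1 X2
    by (subst mult_four_block_mat[of _ k n1 _ n2 _ 0 _ _ n1 _ n2]) auto
  have "?l = four_block_mat (?C1 * X1 * B1 + ?C2 * X2 * B2) (0\<^sub>m k 0) (0\<^sub>m 0 k) (0\<^sub>m 0 0)"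
    unfolding TX unfolding B using C X1 X2 B1 B2
    by (subst mult_four_block_mat[of _ k n1 _ n2 _ 0 _ _ k _ 0]) auto
  also have "\<dots> = ?r" by (rule eq_matI) (use B1 B2 in auto)
  finally show ?thesis .
qed

section \<open>Laplacians of connected graphs\<close>

definition adjacency :: "'v pair_pre_digraph \<Rightarrow> 'v \<Rightarrow> 'v \<Rightarrow> real" where
  "adjacency H u v = of_bool ((u, v) \<in> parcs H)"

text \<open>
  Connectedness in the form used by the maximum principle: no nonempty proper set of vertices is
  closed under passing to neighbours.
\<close>

definition cut_connected :: "'v pair_pre_digraph \<Rightarrow> bool" where
  "cut_connected H \<longleftrightarrow> (\<forall>S \<subseteq> pverts H. S \<noteq> {} \<longrightarrow>
     (\<forall>(u, v) \<in> parcs H. u \<in> S \<longrightarrow> v \<in> S) \<longrightarrow> S = pverts H)"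

lemma cut_connectedD:
  assumes "cut_connected H" "S \<subseteq> pverts H" "S \<noteq> {}"
    and "\<And>u v. u \<in> S \<Longrightarrow> (u, v) \<in> parcs H \<Longrightarrow> v \<in> S"
  shows "S = pverts H"
  using assms unfolding cut_connected_def by blast

lemma connected_imp_cut_connected:
  assumes H: "pair_graph H" and conn: "Digraph_Component.connected (with_proj H)"
  shows "cut_connected H"
  unfolding cut_connected_def
proof (intro allI impI)
  interpret pair_graph H by fact
  fix S assume S: "S \<subseteq> pverts H" "S \<noteq> {}" and closed: "\<forall>(u, v) \<in> parcs H. u \<in> S \<longrightarrow> v \<in> S"
  obtain u where u: "u \<in> S" using S by auto
  have "v \<in> S" if v: "v \<in> pverts H" for v
  proof -
    have "(u, v) \<in> rtrancl_on (pverts H) ((parcs H)\<^sup>s)"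
      using conn u v S unfolding connected_conv by auto
    then show ?thesis
      by (induction rule: rtrancl_on_induct)
        (use u closed in \<open>auto simp: symcl_def dest: arcs_symmetric\<close>)
  qed
  then show "S = pverts H" using S by auto
qed

lemma laplacian_entry_adjacency:
  assumes H: "pair_graph H"
  shows "laplacian_entry H u v = (if u = v then \<Sum>w\<in>pverts H. adjacency H u w else 0) - adjacency H u v"
proof -
  interpret pair_graph H by fact
  have "out_degree (with_proj H) u = card (Pair u ` {w \<in> pverts H. (u, w) \<in> parcs H})"
    unfolding out_degree_def by (rule arg_cong[where f = card]) (auto simp: out_arcs_def in_arcsD2)
  also have "\<dots> = card {w \<in> pverts H. (u, w) \<in> parcs H}" by (rule card_image) (simp add: inj_on_def)
  finally have "real (out_degree (with_proj H) u) = (\<Sum>w\<in>pverts H. adjacency H u w)"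
    using pair_finite_verts by (simp add: adjacency_def Int_def sum_of_bool_eq)
  moreover have "adjacency H u u = 0" using no_loops' by (auto simp: adjacency_def)
  ultimately show ?thesis
    by (cases "u = v") (simp_all add: laplacian_entry_def, simp add: adjacency_def)
qed

lemma laplacian_entry_sym:
  assumes H: "pair_graph H" shows "laplacian_entry H u v = laplacian_entry H v u"
proof -
  interpret pair_graph H by fact
  show ?thesis by (auto simp: laplacian_entry_def dest: arcs_symmetric)
qed

text \<open>
  The Laplacian acts on functions by summing differences over neighbours. In this form all terms
  have the same sign at a maximum of the function.
\<close>

lemma laplacian_apply:
  assumes H: "pair_graph H" and u: "u \<in> pverts H"
  shows "(\<Sum>v\<in>pverts H. laplacian_entry H u v * f v) = (\<Sum>v\<in>pverts H. adjacency H u v * (f u - f v))"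
proof -
  interpret pair_graph H by fact
  have "(\<Sum>v\<in>pverts H. laplacian_entry H u v * f v)
      = (\<Sum>v\<in>pverts H. (if v = u then (\<Sum>w\<in>pverts H. adjacency H u w) * f u else 0) - adjacency H u v * f v)"
    by (intro sum.cong) (auto simp: laplacian_entry_adjacency[OF H] algebra_simps)
  also have "\<dots> = (\<Sum>w\<in>pverts H. adjacency H u w) * f u - (\<Sum>v\<in>pverts H. adjacency H u v * f v)"
    unfolding sum_subtractf using u pair_finite_verts by simp
  finally show ?thesis by (simp add: sum_distrib_right right_diff_distrib sum_subtractf)
qed

lemma laplacian_entry_sum:
  assumes "pair_graph H" "u \<in> pverts H"
  shows "(\<Sum>v\<in>pverts H. laplacian_entry H u v) = 0"
  using laplacian_apply[OF assms, of "\<lambda>_. 1"] by simp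

text \<open>
  At a vertex where a positive maximum is attained, all differences to the neighbours are
  nonnegative and sum to zero, so the neighbours attain the maximum too. By connectedness the
  maximum is attained everywhere, in particular at \<open>y\<close>.
\<close>

lemma maximum_principle:
  assumes H: "pair_graph H" and conn: "cut_connected H"
    and harmonic: "\<And>u. u \<in> pverts H \<Longrightarrow> f u > 0 \<Longrightarrow> (\<Sum>v\<in>pverts H. adjacency H u v * (f u - f v)) = 0"
    and y: "y \<in> pverts H" "f y \<le> 0" and u: "u \<in> pverts H"
  shows "f u \<le> (0 :: real)"
proof (rule ccontr)
  assume pos: "\<not> f u \<le> 0"
  interpret pair_graph H by fact
  define c where "c = Max (f ` pverts H)"
  have le: "f v \<le> c" if "v \<in> pverts H" for v
    using that pair_finite_verts unfolding c_def by simp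
  have c: "c > 0" using le[OF u] pos by simp
  define S where "S = {v \<in> pverts H. f v = c}"
  have "c \<in> f ` pverts H" unfolding c_def using u pair_finite_verts by (intro Max_in) auto
  then have "S \<noteq> {}" by (auto simp: S_def)
  moreover have "w \<in> S" if "v \<in> S" "(v, w) \<in> parcs H" for v w
  proof -
    have v: "v \<in> pverts H" "f v = c" using that by (auto simp: S_def)
    have w: "w \<in> pverts H" using that in_arcsD2 by blast
    have "(\<Sum>w\<in>pverts H. adjacency H v w * (f v - f w)) = 0"
      by (rule harmonic[OF v(1)]) (simp add: v c)
    moreover have "adjacency H v w * (f v - f w) \<ge> 0" if "w \<in> pverts H" for w
      using le[OF that] v by (simp add: adjacency_def)
    ultimately have "\<forall>w\<in>pverts H. adjacency H v w * (f v - f w) = 0"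
      using sum_nonneg_eq_0_iff[OF pair_finite_verts, of "\<lambda>w. adjacency H v w * (f v - f w)"] by blast
    then show ?thesis using that w v by (auto simp: adjacency_def S_def)
  qed
  moreover have "S \<subseteq> pverts H" by (auto simp: S_def)
  ultimately have "S = pverts H" using cut_connectedD[OF conn] by blast
  then have "y \<in> S" using y by simp
  then show False using y c by (simp add: S_def)
qed

lemma sum_nth_distinct:
  assumes "distinct xs" shows "(\<Sum>j<length xs. g (xs ! j)) = (\<Sum>v\<in>set xs. g v)"
  using sum.reindex_bij_betw[OF bij_betw_nth[OF assms refl refl]] .

lemma laplacian_row_sums:
  assumes "pair_graph H" "distinct vs" "set vs = pverts H" "i < length vs"
  shows "(\<Sum>j<length vs. laplacian H vs $$ (i, j)) = 0"
proof -
  have "(\<Sum>j<length vs. laplacian H vs $$ (i, j)) = (\<Sum>v\<in>set vs. laplacian_entry H (vs ! i) v)"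
    using assms(4) by (simp add: laplacian_def sum_nth_distinct[OF assms(2)])
  also have "\<dots> = 0"
    unfolding assms(3) using nth_mem[OF assms(4)] assms(3) by (intro laplacian_entry_sum[OF assms(1)]) simp
  finally show ?thesis .
qed

text \<open>
  A kernel vector, extended by zero outside \<open>xs\<close>, is harmonic at every vertex of
  \<open>xs\<close>, in particular wherever it is nonzero. The maximum principle for it and for
  its negative forces it to vanish.
\<close>

lemma det_dirichlet_laplacian_nonzero:
  assumes H: "pair_graph H" and conn: "cut_connected H"
    and xs: "distinct xs" "set xs \<subset> pverts H"
  shows "det (laplacian H xs) \<noteq> 0"
proof
  interpret pair_graph H by fact
  let ?m = "length xs"
  have L: "laplacian H xs \<in> carrier_mat ?m ?m" by (simp add: laplacian_def)
  assume "det (laplacian H xs) = 0"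
  then obtain v where v: "v \<in> carrier_vec ?m" "v \<noteq> 0\<^sub>v ?m" and Lv: "laplacian H xs *\<^sub>v v = 0\<^sub>v ?m"
    using det_0_iff_vec_prod_zero[OF L] by auto
  obtain y where y: "y \<in> pverts H" "y \<notin> set xs" using xs by auto
  define f where "f u = (if u \<in> set xs then v $ inv_into {..<?m} ((!) xs) u else 0)" for u
  have inj: "inj_on ((!) xs) {..<?m}" using xs(1) by (simp add: inj_on_nth)
  have f_nth: "f (xs ! i) = v $ i" if "i < ?m" for i
    using that inv_into_f_f[OF inj, of i] by (simp add: f_def)
  have f_out: "f u = 0" if "u \<notin> set xs" for u using that by (simp add: f_def)
  have harm: "(\<Sum>w\<in>pverts H. adjacency H u w * (f u - f w)) = 0" if u: "u \<in> set xs" for u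
  proof -
    obtain i where i: "i < ?m" "u = xs ! i" using u by (auto simp: in_set_conv_nth)
    have "0 = (laplacian H xs *\<^sub>v v) $ i" using i by (simp add: Lv)
    also have "\<dots> = (\<Sum>j<?m. laplacian_entry H u (xs ! j) * f (xs ! j))"
      using i v(1) f_nth by (auto simp: laplacian_def scalar_prod_def lessThan_atLeast0 intro!: sum.cong)
    also have "\<dots> = (\<Sum>w\<in>set xs. laplacian_entry H u w * f w)" by (rule sum_nth_distinct[OF xs(1)])
    also have "\<dots> = (\<Sum>w\<in>pverts H. laplacian_entry H u w * f w)"
      using xs(2) pair_finite_verts f_out by (intro sum.mono_neutral_left) auto
    also have "\<dots> = (\<Sum>w\<in>pverts H. adjacency H u w * (f u - f w))"
      using u xs(2) by (intro laplacian_apply[OF H]) auto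
    finally show ?thesis ..
  qed
  have "f u \<le> 0" if "u \<in> pverts H" for u
    by (rule maximum_principle[OF H conn _ y(1) _ that]) (use harm f_out y in force)+
  moreover have "- f u \<le> 0" if "u \<in> pverts H" for u
  proof (rule maximum_principle[OF H conn _ y(1) _ that])
    fix u assume "- f u > 0"
    then have "u \<in> set xs" using f_out[of u] by auto
    then have "- (\<Sum>w\<in>pverts H. adjacency H u w * (f u - f w)) = 0" using harm by simp
    then show "(\<Sum>w\<in>pverts H. adjacency H u w * (- f u - - f w)) = 0"
      by (simp add: sum_negf[symmetric] algebra_simps)
  qed (use f_out y in simp)
  ultimately have "f u = 0" if "u \<in> pverts H" for u using that by force
  then have "v $ i = 0" if "i < ?m" for i
  proof -
    have "xs ! i \<in> pverts H" using xs(2) nth_mem[OF that] by blast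
    then show ?thesis using f_nth[OF that] \<open>\<And>u. u \<in> pverts H \<Longrightarrow> f u = 0\<close> by metis
  qed
  then have "v = 0\<^sub>v ?m" using v(1) by (intro eq_vecI) auto
  then show False using v(2) by simp
qed

text \<open>
  Zero row sums turn this determinant into that of the Laplacian restricted to all vertices but
  the last one, a proper subset of the vertices.
\<close>

lemma det_laplacian_corner_nonzero:
  assumes H: "pair_graph H" and conn: "cut_connected H" and vs: "distinct vs" "set vs = pverts H"
    and ne: "vs \<noteq> []"
  shows "det (laplacian H vs + corner_mat (length vs)) \<noteq> 0"
proof -
  \<comment> \<open>The vertex \<open>y\<close> plays the role of the boundary.\<close>
  obtain us y where us: "vs = us @ [y]" using ne by (metis append_butlast_last_id)
  have "laplacian H vs \<in> carrier_mat (Suc (length us)) (Suc (length us))"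
    by (simp add: laplacian_def us)
  then have "det (laplacian H vs + corner_mat (length vs))
      = det (mat (length us) (length us) (\<lambda>p. laplacian H vs $$ p))"
    using det_add_corner_mat[of "laplacian H vs" "length us"] laplacian_row_sums[OF H vs]
    by (simp add: us)
  also have "mat (length us) (length us) (\<lambda>p. laplacian H vs $$ p) = laplacian H us"
    by (rule eq_matI) (auto simp: laplacian_def us nth_append)
  also have "det \<dots> \<noteq> 0"
    by (rule det_dirichlet_laplacian_nonzero[OF H conn]) (use vs us in auto)
  finally show ?thesis .
qed

text \<open>
  Conjugation by the permutation matrix between the two enumerations.
\<close>

lemma laplacian_reorder_similar:
  assumes "distinct vs" "distinct ws" "set vs = set ws"
  shows "similar_mat (laplacian H vs) (laplacian H ws)"
proof -
  let ?n = "length vs"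
  have len: "length ws = ?n" using assms by (metis distinct_card)
  define perm :: "'a list \<Rightarrow> 'a list \<Rightarrow> real mat" where
    "perm us us' = mat ?n ?n (\<lambda>(i, j). of_bool (us ! i = us' ! j))" for us us'
  have P: "perm us us' \<in> carrier_mat ?n ?n" for us us' by (simp add: perm_def)
  have left: "perm us us' * mat ?n ?n (\<lambda>(i, j). g (us' ! i) j) = mat ?n ?n (\<lambda>(i, j). g (us ! i) j)"
    if us: "set us = set us'" "length us = ?n" "length us' = ?n" "distinct us'" for us us' :: "'a list" and g
  proof (rule eq_matI, goal_cases)
    case (1 i j)
    then have ij: "i < ?n" "j < ?n" by auto
    have "(perm us us' * mat ?n ?n (\<lambda>(i, j). g (us' ! i) j)) $$ (i, j)
        = (\<Sum>k<length us'. of_bool (us ! i = us' ! k) * g (us' ! k) j)"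
      using ij us by (auto simp: perm_def scalar_prod_def lessThan_atLeast0 intro!: sum.cong)
    also have "\<dots> = (\<Sum>w\<in>set us'. of_bool (us ! i = w) * g w j)"
      using us by (rule_tac sum_nth_distinct)
    also have "\<dots> = (\<Sum>w\<in>set us'. if w = us ! i then g w j else 0)" by (intro sum.cong) auto
    also have "\<dots> = g (us ! i) j" using ij us by (metis List.finite_set nth_mem sum.delta)
    finally show ?case using ij by simp
  qed (simp_all add: perm_def)
  have one: "mat ?n ?n (\<lambda>(i, j). of_bool (us ! i = us ! j)) = (1\<^sub>m ?n :: real mat)"
    if "distinct us" "length us = ?n" for us :: "'a list"
    using that by (intro eq_matI) (auto simp: nth_eq_iff_index_eq)
  have inv: "perm us us' * perm us' us = 1\<^sub>m ?n"
    if "set us = set us'" "length us = ?n" "length us' = ?n" "distinct us'" "distinct us" for us us'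
    using left[OF that(1-4), of "\<lambda>w j. of_bool (w = us ! j)"] one[OF that(5,2)] unfolding perm_def by simp
  let ?K = "mat ?n ?n (\<lambda>(i, j). laplacian_entry H (vs ! i) (ws ! j))"
  have "perm vs ws * laplacian H ws = ?K"
    using left[of vs ws "\<lambda>w j. laplacian_entry H w (ws ! j)"] assms len by (simp add: laplacian_def)
  moreover have "?K * perm ws vs = laplacian H vs"
  proof -
    have "transpose_mat (?K * perm ws vs) = transpose_mat (perm ws vs) * transpose_mat ?K"
      using P[of ws vs] by (intro transpose_mult) auto
    also have "transpose_mat (perm ws vs) = perm vs ws" by (rule eq_matI) (auto simp: perm_def)
    also have "transpose_mat ?K = mat ?n ?n (\<lambda>(i, j). laplacian_entry H (vs ! j) (ws ! i))"
      by (rule eq_matI) auto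
    also have "perm vs ws * \<dots> = mat ?n ?n (\<lambda>(i, j). laplacian_entry H (vs ! j) (vs ! i))"
      using left[of vs ws "\<lambda>w j. laplacian_entry H (vs ! j) w"] assms len by simp
    also have "\<dots> = transpose_mat (laplacian H vs)" by (rule eq_matI) (auto simp: laplacian_def)
    finally show ?thesis by (simp only: transpose_mat_eq)
  qed
  ultimately show ?thesis
    using assms len inv[of vs ws] inv[of ws vs] P
    by (intro similar_matI[of _ _ "perm vs ws" "perm ws vs" ?n]) (auto simp: laplacian_def)
qed

definition lap_block :: "'v pair_pre_digraph \<Rightarrow> 'v list \<Rightarrow> 'v list \<Rightarrow> real mat" where
  "lap_block H us vs = mat (length us) (length vs) (\<lambda>(i, j). laplacian_entry H (us ! i) (vs ! j))"

lemma lap_block_carrier [simp]: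
  "lap_block H us vs \<in> carrier_mat (length us) (length vs)"
  "dim_row (lap_block H us vs) = length us" "dim_col (lap_block H us vs) = length vs"
  by (simp_all add: lap_block_def)

lemma laplacian_carrier [simp]:
  "laplacian H vs \<in> carrier_mat (length vs) (length vs)"
  "dim_row (laplacian H vs) = length vs" "dim_col (laplacian H vs) = length vs"
  by (simp_all add: laplacian_def)

lemma transpose_lap_block:
  assumes "pair_graph H"
  shows "transpose_mat (lap_block H us vs) = lap_block H vs us"
  using laplacian_entry_sym[OF assms] by (intro eq_matI) (auto simp: lap_block_def)

lemma transpose_laplacian:
  assumes "pair_graph H" shows "transpose_mat (laplacian H vs) = laplacian H vs"
  using laplacian_entry_sym[OF assms] by (intro eq_matI) (auto simp: laplacian_def)

lemma laplacian_append:
  assumes "pair_graph H"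
  shows "laplacian H (us @ vs) = four_block_mat (laplacian H us) (lap_block H us vs)
    (transpose_mat (lap_block H us vs)) (laplacian H vs)"
  unfolding transpose_lap_block[OF assms]
  by (rule eq_matI) (auto simp: laplacian_def lap_block_def nth_append)

lemma DN_lap_block:
  assumes "pair_graph H"
  shows "DN H xs ys = laplacian H ys
    - transpose_mat (lap_block H xs ys) * the (mat_inverse (laplacian H xs)) * lap_block H xs ys"
proof -
  have "mat (length xs) (length xs) (\<lambda>p. laplacian H (xs @ ys) $$ p) = laplacian H xs"
    "mat (length xs) (length ys) (\<lambda>(i, j). laplacian H (xs @ ys) $$ (i, j + length xs))
      = lap_block H xs ys"
    "mat (length ys) (length ys) (\<lambda>(i, j). laplacian H (xs @ ys) $$ (i + length xs, j + length xs))
      = laplacian H ys"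
    by (rule eq_matI; simp add: laplacian_def lap_block_def nth_append)+
  then show ?thesis by (simp add: DN_def split_block_def Let_def)
qed

section \<open>Glued graphs\<close>

locale gluing =
  fixes G1 G2 Y :: "'v pair_pre_digraph"
  assumes G1: "pair_graph G1" and G2: "pair_graph G2" and Y: "pair_graph Y"
    and conn1: "Digraph_Component.connected (with_proj G1)"
    and conn2: "Digraph_Component.connected (with_proj G2)"
    and Y_nonempty: "pverts Y \<noteq> {}"
    and full1: "induced_subgraph (with_proj Y) (with_proj G1)"
    and full2: "induced_subgraph (with_proj Y) (with_proj G2)"
begin

abbreviation "G \<equiv> glue G1 Y G2"
abbreviation "c1 u \<equiv> glue_class Y (Inl u)"
abbreviation "c2 u \<equiv> glue_class Y (Inr u)"

lemma glue_class_Inl: "c1 u = insert (Inl u) (if u \<in> pverts Y then {Inr u} else {})"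
  by (auto simp: glue_class_def doubleton_eq_iff)

lemma glue_class_Inr: "c2 u = insert (Inr u) (if u \<in> pverts Y then {Inl u} else {})"
  by (auto simp: glue_class_def doubleton_eq_iff)

lemma glue_class_eq_iff [simp]:
  "c1 u = c1 v \<longleftrightarrow> u = v" "c2 u = c2 v \<longleftrightarrow> u = v"
  "c1 u = c2 v \<longleftrightarrow> u = v \<and> u \<in> pverts Y" "c2 v = c1 u \<longleftrightarrow> u = v \<and> u \<in> pverts Y"
  by (auto simp: glue_class_Inl glue_class_Inr split: if_splits)

lemma Y_verts: "pverts Y \<subseteq> pverts G1" "pverts Y \<subseteq> pverts G2"
proof -
  show "pverts Y \<subseteq> pverts G1" using full1 by (simp add: induced_subgraph_def subgraph_def)
  show "pverts Y \<subseteq> pverts G2" using full2 by (simp add: induced_subgraph_def subgraph_def)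
qed

lemma Y_arcs:
  "(u, v) \<in> parcs Y \<longleftrightarrow> (u, v) \<in> parcs G1 \<and> u \<in> pverts Y \<and> v \<in> pverts Y"
  "(u, v) \<in> parcs Y \<longleftrightarrow> (u, v) \<in> parcs G2 \<and> u \<in> pverts Y \<and> v \<in> pverts Y"
proof -
  show "(u, v) \<in> parcs Y \<longleftrightarrow> (u, v) \<in> parcs G1 \<and> u \<in> pverts Y \<and> v \<in> pverts Y"
    using full1 by (simp add: induced_subgraph_def)
  show "(u, v) \<in> parcs Y \<longleftrightarrow> (u, v) \<in> parcs G2 \<and> u \<in> pverts Y \<and> v \<in> pverts Y"
    using full2 by (simp add: induced_subgraph_def)
qed

lemma glue_arc_iff:
  "(a, b) \<in> parcs G \<longleftrightarrow> (\<exists>u v. (u, v) \<in> parcs G1 \<and> a = c1 u \<and> b = c1 v)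
    \<or> (\<exists>u v. (u, v) \<in> parcs G2 \<and> a = c2 u \<and> b = c2 v)"
  by (auto simp: glue_def)

lemma glue_verts: "pverts G = c1 ` pverts G1 \<union> c2 ` pverts G2"
  by (auto simp: glue_def Plus_def)

lemma pair_graph_glue: "pair_graph G"
proof -
  interpret G1: pair_graph G1 by (rule G1)
  interpret G2: pair_graph G2 by (rule G2)
  show ?thesis
  proof (unfold_locales, goal_cases)
    case (1 e) then show ?case
      using glue_arc_iff[of "fst e" "snd e"] by (auto simp: glue_verts dest: G1.in_arcsD1 G2.in_arcsD1)
  next
    case (2 e) then show ?case
      using glue_arc_iff[of "fst e" "snd e"] by (auto simp: glue_verts dest: G1.in_arcsD2 G2.in_arcsD2)
  next
    case 3 show ?case using G1.pair_finite_verts G2.pair_finite_verts by (simp add: glue_verts)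
  next
    case 4 show ?case using G1.pair_finite_arcs G2.pair_finite_arcs by (simp add: glue_def)
  next
    case (5 e) then show ?case
      using glue_arc_iff[of "fst e" "snd e"] by (auto dest: G1.no_loops' G2.no_loops')
  next
    case 6 show ?case
      by (auto simp: symmetric_def sym_def glue_arc_iff dest: G1.arcs_symmetric G2.arcs_symmetric)
  qed
qed

text \<open>
  A closed set of vertices meets each of the two graphs in a closed set, hence in nothing or in
  everything, and both graphs contain the nonempty set of vertices of \<open>Y\<close>.
\<close>

lemma cut_connected_glue: "cut_connected G"
  unfolding cut_connected_def
proof (intro allI impI)
  interpret G1: pair_graph G1 by (rule G1)
  interpret G2: pair_graph G2 by (rule G2)
  fix S assume S: "S \<subseteq> pverts G" "S \<noteq> {}" and closed: "\<forall>(a, b) \<in> parcs G. a \<in> S \<longrightarrow> b \<in> S"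
  have step: "b \<in> S" if "(a, b) \<in> parcs G" "a \<in> S" for a b using closed that by auto
  define S1 where "S1 = {u \<in> pverts G1. c1 u \<in> S}"
  define S2 where "S2 = {u \<in> pverts G2. c2 u \<in> S}"
  have all1: "S1 = {} \<or> S1 = pverts G1"
  proof -
    have closed1: "v \<in> S1" if "u \<in> S1" "(u, v) \<in> parcs G1" for u v
      using that step[of "c1 u" "c1 v"] G1.in_arcsD2[of u v] by (auto simp: glue_arc_iff S1_def S2_def)
    have sub: "S1 \<subseteq> pverts G1" by (auto simp: S1_def)
    have "S1 = pverts G1" if "S1 \<noteq> {}"
      by (rule cut_connectedD[OF connected_imp_cut_connected[OF G1 conn1] sub that closed1])
    then show ?thesis by blast
  qed
  have all2: "S2 = {} \<or> S2 = pverts G2"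
  proof -
    have closed2: "v \<in> S2" if "u \<in> S2" "(u, v) \<in> parcs G2" for u v
      using that step[of "c2 u" "c2 v"] G2.in_arcsD2[of u v] by (auto simp: glue_arc_iff S1_def S2_def)
    have sub: "S2 \<subseteq> pverts G2" by (auto simp: S2_def)
    have "S2 = pverts G2" if "S2 \<noteq> {}"
      by (rule cut_connectedD[OF connected_imp_cut_connected[OF G2 conn2] sub that closed2])
    then show ?thesis by blast
  qed
  obtain y where y: "y \<in> pverts Y" using Y_nonempty by auto
  have "c1 y = c2 y" using y by simp
  then have "c1 y \<in> S \<longleftrightarrow> c2 y \<in> S" by (simp only:)
  then have meet: "y \<in> S1 \<longleftrightarrow> y \<in> S2" using y Y_verts by (auto simp: S1_def S2_def)
  have yV: "y \<in> pverts G1" "y \<in> pverts G2" using y Y_verts by auto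
  have ne: "S1 \<noteq> {} \<or> S2 \<noteq> {}" using S by (auto simp: glue_verts S1_def S2_def)
  have "y \<in> S1" using all1 all2 ne yV meet by blast
  then have "S1 = pverts G1" "S2 = pverts G2" using all1 all2 meet by auto
  then show "S = pverts G" using S(1) by (auto simp: glue_verts S1_def S2_def)
qed

text \<open>
  Since \<open>Y\<close> is full in both graphs, gluing creates no new edge between vertices of
  the same graph.
\<close>

lemma arcs_agree_on_Y:
  "u \<in> pverts Y \<Longrightarrow> v \<in> pverts Y \<Longrightarrow> (u, v) \<in> parcs G1 \<longleftrightarrow> (u, v) \<in> parcs G2"
  using Y_arcs[of u v] by blast

lemma glue_arc_classes:
  "(c1 u, c1 v) \<in> parcs G \<longleftrightarrow> (u, v) \<in> parcs G1"
  "(c2 u, c2 v) \<in> parcs G \<longleftrightarrow> (u, v) \<in> parcs G2"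
proof -
  show "(c1 u, c1 v) \<in> parcs G \<longleftrightarrow> (u, v) \<in> parcs G1"
    using arcs_agree_on_Y[of u v] by (auto simp: glue_arc_iff)
  show "(c2 u, c2 v) \<in> parcs G \<longleftrightarrow> (u, v) \<in> parcs G2"
    using arcs_agree_on_Y[of u v] by (auto simp: glue_arc_iff)
qed

lemma glue_arc_across:
  assumes "u \<notin> pverts Y" "v \<notin> pverts Y"
  shows "(c1 u, c2 v) \<notin> parcs G" "(c2 u, c1 v) \<notin> parcs G"
  using assms by (auto simp: glue_arc_iff)

lemma adjacency_glue:
  "adjacency G (c1 u) (c1 v) = adjacency G1 u v"
  "adjacency G (c2 u) (c2 v) = adjacency G2 u v"
  "u \<notin> pverts Y \<Longrightarrow> v \<notin> pverts Y \<Longrightarrow> adjacency G (c1 u) (c2 v) = 0"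
  "u \<notin> pverts Y \<Longrightarrow> v \<notin> pverts Y \<Longrightarrow> adjacency G (c2 u) (c1 v) = 0"
  by (simp_all add: adjacency_def glue_arc_classes glue_arc_across)

lemma adjacency_Y: "u \<in> pverts Y \<Longrightarrow> v \<in> pverts Y \<Longrightarrow> adjacency G1 u v = adjacency Y u v"
  "u \<in> pverts Y \<Longrightarrow> v \<in> pverts Y \<Longrightarrow> adjacency G2 u v = adjacency Y u v"
  using Y_arcs[of u v] by (simp_all add: adjacency_def)

lemma finite_verts: "finite (pverts G1)" "finite (pverts G2)" "finite (pverts Y)"
proof -
  interpret G1: pair_graph G1 by (rule G1)
  interpret G2: pair_graph G2 by (rule G2)
  interpret Y: pair_graph Y by (rule Y)
  show "finite (pverts G1)" "finite (pverts G2)" "finite (pverts Y)"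
    by (rule G1.pair_finite_verts G2.pair_finite_verts Y.pair_finite_verts)+
qed

lemma sum_split:
  fixes h :: "'v \<Rightarrow> real"
  shows "sum h (pverts G1) = sum h (pverts G1 - pverts Y) + sum h (pverts Y)"
    "sum h (pverts G2) = sum h (pverts G2 - pverts Y) + sum h (pverts Y)"
  by (rule sum.subset_diff; use Y_verts finite_verts in simp)+

lemma sum_glue_verts:
  fixes h :: "('v + 'v) set \<Rightarrow> real"
  shows "sum h (pverts G) = (\<Sum>u\<in>pverts G1 - pverts Y. h (c1 u))
    + (\<Sum>u\<in>pverts G2 - pverts Y. h (c2 u)) + (\<Sum>u\<in>pverts Y. h (c1 u))"
proof -
  let ?X1 = "pverts G1 - pverts Y" and ?X2 = "pverts G2 - pverts Y"
  have split: "f ` A = f ` (A - B) \<union> f ` B" if "B \<subseteq> A"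
    for A B and f :: "'v \<Rightarrow> ('v + 'v) set" using that by blast
  have onY: "c2 ` pverts Y = c1 ` pverts Y" by (intro image_cong) auto
  have "pverts G = (c1 ` ?X1 \<union> c1 ` pverts Y) \<union> (c2 ` ?X2 \<union> c1 ` pverts Y)"
    unfolding glue_verts split[OF Y_verts(1), of "\<lambda>u. c1 u"] split[OF Y_verts(2), of "\<lambda>u. c2 u"] onY ..
  also have "\<dots> = (c1 ` ?X1 \<union> c2 ` ?X2) \<union> c1 ` pverts Y" by (simp only: Un_ac Un_absorb Un_left_absorb)
  also have "sum h \<dots> = sum h (c1 ` ?X1) + sum h (c2 ` ?X2) + sum h (c1 ` pverts Y)"
  proof -
    have "c1 ` ?X1 \<inter> c2 ` ?X2 = {}" "(c1 ` ?X1 \<union> c2 ` ?X2) \<inter> c1 ` pverts Y = {}" by auto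
    moreover have "finite (c1 ` ?X1)" "finite (c2 ` ?X2)" "finite (c1 ` pverts Y)"
      using finite_verts by simp_all
    ultimately show ?thesis by (simp only: sum.union_disjoint finite_UnI)
  qed
  also have "\<dots> = (\<Sum>u\<in>?X1. h (c1 u)) + (\<Sum>u\<in>?X2. h (c2 u)) + (\<Sum>u\<in>pverts Y. h (c1 u))"
    by (simp add: sum.reindex inj_on_def)
  finally show ?thesis .
qed

text \<open>
  At a vertex of \<open>Y\<close>, the edges inside \<open>Y\<close> are counted by both degrees
  but occur once in the glued graph.
\<close>

lemma degree_glue:
  "u \<in> pverts G1 - pverts Y \<Longrightarrow> sum (adjacency G (c1 u)) (pverts G) = sum (adjacency G1 u) (pverts G1)"
  "u \<in> pverts G2 - pverts Y \<Longrightarrow> sum (adjacency G (c2 u)) (pverts G) = sum (adjacency G2 u) (pverts G2)"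
  "u \<in> pverts Y \<Longrightarrow> sum (adjacency G (c1 u)) (pverts G)
     = sum (adjacency G1 u) (pverts G1) + sum (adjacency G2 u) (pverts G2) - sum (adjacency Y u) (pverts Y)"
proof -
  have Yc: "c1 v = c2 v" if "v \<in> pverts Y" for v using that by simp
  show "sum (adjacency G (c1 u)) (pverts G) = sum (adjacency G1 u) (pverts G1)"
    if "u \<in> pverts G1 - pverts Y"
    using that Y_verts unfolding sum_glue_verts sum_split by (simp add: adjacency_glue subset_iff)
  show "sum (adjacency G (c2 u)) (pverts G) = sum (adjacency G2 u) (pverts G2)"
    if "u \<in> pverts G2 - pverts Y"
    using that Y_verts unfolding sum_glue_verts sum_split by (simp add: adjacency_glue subset_iff Yc)
  show "sum (adjacency G (c1 u)) (pverts G)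
     = sum (adjacency G1 u) (pverts G1) + sum (adjacency G2 u) (pverts G2) - sum (adjacency Y u) (pverts Y)"
    if u: "u \<in> pverts Y"
  proof -
    have "(\<Sum>v\<in>pverts G2 - pverts Y. adjacency G (c1 u) (c2 v)) = sum (adjacency G2 u) (pverts G2 - pverts Y)"
      using u Y_verts unfolding Yc[OF u] by (intro sum.cong) (auto simp: adjacency_glue)
    then show ?thesis
      using u Y_verts unfolding sum_glue_verts sum_split by (simp add: adjacency_glue adjacency_Y subset_iff)
  qed
qed

lemma laplacian_entry_glue:
  "u \<in> pverts G1 - pverts Y \<Longrightarrow> v \<in> pverts G1 \<Longrightarrow>
     laplacian_entry G (c1 u) (c1 v) = laplacian_entry G1 u v"
  "u \<in> pverts G2 - pverts Y \<Longrightarrow> v \<in> pverts G2 \<Longrightarrow>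
     laplacian_entry G (c2 u) (c2 v) = laplacian_entry G2 u v"
  "u \<in> pverts G1 - pverts Y \<Longrightarrow> v \<in> pverts G2 - pverts Y \<Longrightarrow>
     laplacian_entry G (c1 u) (c2 v) = 0"
  "u \<in> pverts G2 - pverts Y \<Longrightarrow> v \<in> pverts G1 - pverts Y \<Longrightarrow>
     laplacian_entry G (c2 u) (c1 v) = 0"
  "u \<in> pverts Y \<Longrightarrow> v \<in> pverts Y \<Longrightarrow> laplacian_entry G (c1 u) (c1 v)
     = laplacian_entry G1 u v + laplacian_entry G2 u v - laplacian_entry Y u v"
  using Y_verts
  by (auto simp: laplacian_entry_adjacency[OF G1] laplacian_entry_adjacency[OF G2] laplacian_entry_adjacency[OF Y]
      laplacian_entry_adjacency[OF pair_graph_glue] degree_glue adjacency_glue adjacency_Y)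

lemma laplacian_glue_blocks:
  assumes xs1: "set xs1 = pverts G1 - pverts Y" and xs2: "set xs2 = pverts G2 - pverts Y"
    and ys: "set ys = pverts Y"
  shows "laplacian G (map c1 xs1 @ map c2 xs2)
      = four_block_mat (laplacian G1 xs1) (0\<^sub>m (length xs1) (length xs2))
          (0\<^sub>m (length xs2) (length xs1)) (laplacian G2 xs2)"
    and "lap_block G (map c1 xs1 @ map c2 xs2) (map c1 ys) = lap_block G1 xs1 ys @\<^sub>r lap_block G2 xs2 ys"
    and "laplacian G (map c1 ys) = laplacian G1 ys + laplacian G2 ys - laplacian Y ys"
proof -
  have x1: "xs1 ! i \<in> pverts G1 - pverts Y" if "i < length xs1" for i using that xs1 nth_mem by blast
  have x2: "xs2 ! i \<in> pverts G2 - pverts Y" if "i < length xs2" for i using that xs2 nth_mem by blast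
  have y: "ys ! i \<in> pverts Y" if "i < length ys" for i using that ys nth_mem by blast
  have y1: "ys ! i \<in> pverts G1" "ys ! i \<in> pverts G2" "c1 (ys ! i) = c2 (ys ! i)"
    if "i < length ys" for i using y[OF that] Y_verts by auto
  show "laplacian G (map c1 xs1 @ map c2 xs2)
      = four_block_mat (laplacian G1 xs1) (0\<^sub>m (length xs1) (length xs2))
          (0\<^sub>m (length xs2) (length xs1)) (laplacian G2 xs2)"
    by (rule eq_matI) (use x1 x2 in \<open>auto simp: laplacian_def nth_append laplacian_entry_glue\<close>)
  show "lap_block G (map c1 xs1 @ map c2 xs2) (map c1 ys) = lap_block G1 xs1 ys @\<^sub>r lap_block G2 xs2 ys"
  proof (rule eq_matI, goal_cases)
    case (1 i j)
    then have j: "j < length ys" and i: "i < length xs1 + length xs2" by (auto simp: append_rows_def)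
    show ?case
    proof (cases "i < length xs1")
      case True
      then show ?thesis using j x1 y1 by (simp add: lap_block_def append_rows_def nth_append laplacian_entry_glue)
    next
      case False
      then have i': "i - length xs1 < length xs2" using i by simp
      \<comment> \<open>On \<open>Y\<close> the classes from \<open>G1\<close> and \<open>G2\<close> coincide, so the entry lies inside \<open>G2\<close>.\<close>
      have "laplacian_entry G (c2 (xs2 ! (i - length xs1))) (c1 (ys ! j))
          = laplacian_entry G2 (xs2 ! (i - length xs1)) (ys ! j)"
        unfolding y1(3)[OF j] using i' j x2 y1 by (intro laplacian_entry_glue)
      then show ?thesis using False j i i' by (simp add: lap_block_def append_rows_def nth_append)
    qed
  qed (simp_all add: append_rows_def)
  show "laplacian G (map c1 ys) = laplacian G1 ys + laplacian G2 ys - laplacian Y ys"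
    by (rule eq_matI) (use y in \<open>auto simp: laplacian_def laplacian_entry_glue\<close>)
qed

text \<open>
  The vertices of the glued graph are enumerated as interior of \<open>G1\<close>, interior of
  \<open>G2\<close>, and \<open>Y\<close>. Placing \<open>Y\<close> last makes the corner of the
  Laplacian a corner of the Schur complement.
\<close>

lemma pseudo_det_laplacian_glue:
  assumes xs1: "distinct xs1" "set xs1 = pverts G1 - pverts Y"
    and xs2: "distinct xs2" "set xs2 = pverts G2 - pverts Y"
    and ys: "distinct ys" "set ys = pverts Y"
    and vs: "distinct vs" "set vs = pverts G"
  shows "pseudo_det (laplacian G vs) =
    complex_of_real (real (card (pverts G)) / real (card (pverts Y))
        * det (laplacian G1 xs1) * det (laplacian G2 xs2))
      * pseudo_det (DN_glued G1 xs1 Y ys G2 xs2)"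
proof -
  let ?us = "map c1 xs1 @ map c2 xs2" and ?ws = "map c1 ys"
  let ?n1 = "length xs1" and ?n2 = "length xs2" and ?k = "length ys"
  let ?A1 = "laplacian G1 xs1" and ?A2 = "laplacian G2 xs2"
  let ?X1 = "the (mat_inverse ?A1)" and ?X2 = "the (mat_inverse ?A2)"
  let ?B1 = "lap_block G1 xs1 ys" and ?B2 = "lap_block G2 xs2 ys"
  let ?B = "lap_block G ?us ?ws"
  let ?X = "four_block_mat ?X1 (0\<^sub>m ?n1 ?n2) (0\<^sub>m ?n2 ?n1) ?X2"
  note blocks = laplacian_glue_blocks[OF xs1(2) xs2(2) ys(2)]
  have dist: "distinct (?us @ ?ws)"
    using xs1 xs2 ys by (auto simp: distinct_map inj_on_def)
  have verts: "set (?us @ ?ws) = pverts G"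
    using xs1(2) xs2(2) ys(2) Y_verts by (auto simp: glue_verts image_iff)
  have k: "?k > 0" using ys Y_nonempty by auto
  have card: "card (pverts G) = length (?us @ ?ws)" "card (pverts Y) = ?k"
    using distinct_card[OF dist] distinct_card[OF ys(1)] verts ys(2) by auto
  have det1: "det ?A1 \<noteq> 0"
    using xs1 Y_verts Y_nonempty
    by (intro det_dirichlet_laplacian_nonzero[OF G1 connected_imp_cut_connected[OF G1 conn1]]) auto
  have det2: "det ?A2 \<noteq> 0"
    using xs2 Y_verts Y_nonempty
    by (intro det_dirichlet_laplacian_nonzero[OF G2 connected_imp_cut_connected[OF G2 conn2]]) auto
  note inv1 = mat_inverse_det_nonzero[OF laplacian_carrier(1) det1]
  note inv2 = mat_inverse_det_nonzero[OF laplacian_carrier(1) det2]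
  have AX: "laplacian G ?us * ?X = 1\<^sub>m (length ?us)" "?X * laplacian G ?us = 1\<^sub>m (length ?us)"
    unfolding blocks using inv1 inv2
    by (simp_all add: mult_four_block_mat[of _ ?n1 ?n1 _ ?n2 _ ?n2 _ _ ?n1 _ ?n2])
  have "pseudo_det (laplacian G vs) = pseudo_det (laplacian G (?us @ ?ws))"
    by (rule pseudo_det_similar, rule laplacian_reorder_similar) (use vs dist verts in auto)
  also have "\<dots> = complex_of_real (real (length ?us + ?k) / real ?k * det (laplacian G ?us))
    * pseudo_det (laplacian G ?ws - transpose_mat ?B * ?X * ?B)"
  proof (rule pseudo_det_schur_complement[OF _ _ _ k _ _ _ AX laplacian_append[OF pair_graph_glue]])
    show "?X \<in> carrier_mat (length ?us) (length ?us)" using inv1 inv2 by simp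
    show "(\<Sum>j<length ?us + ?k. laplacian G (?us @ ?ws) $$ (i, j)) = 0" if "i < length ?us + ?k" for i
      using laplacian_row_sums[OF pair_graph_glue dist verts, of i] that by (simp add: add.assoc)
    show "det (laplacian G (?us @ ?ws) + corner_mat (length ?us + ?k)) \<noteq> 0"
      using det_laplacian_corner_nonzero[OF pair_graph_glue cut_connected_glue dist verts] k by (simp add: add.assoc)
    show "laplacian G ?us \<in> carrier_mat (length ?us) (length ?us)" by (rule laplacian_carrier)
    show "?B \<in> carrier_mat (length ?us) ?k" using lap_block_carrier(1)[of G ?us ?ws] by simp
    show "laplacian G ?ws \<in> carrier_mat ?k ?k" using laplacian_carrier(1)[of G ?ws] by simp
  qed (rule transpose_laplacian[OF pair_graph_glue])+
  also have "det (laplacian G ?us) = det ?A1 * det ?A2"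
    unfolding blocks by (rule det_four_block_mat_upper_right_zero) auto
  also have "laplacian G ?ws - transpose_mat ?B * ?X * ?B = DN_glued G1 xs1 Y ys G2 xs2"
  proof -
    have "transpose_mat ?B * ?X * ?B = transpose_mat ?B1 * ?X1 * ?B1 + transpose_mat ?B2 * ?X2 * ?B2"
      unfolding blocks by (rule block_diagonal_congruence) (use inv1 inv2 in auto)
    then show ?thesis
      unfolding DN_glued_def DN_lap_block[OF G1] DN_lap_block[OF G2] blocks
      by (intro eq_matI) (auto simp del: assoc_mult_mat)
  qed
  finally show ?thesis unfolding card by (simp add: mult.assoc)
qed

end

section \<open>The gluing formula for pseudo-determinants\<close>

lemma upper_left_block_laplacian:
  assumes "A \<in> carrier_mat (length xs) (length xs)" "D \<in> carrier_mat (length ys) (length ys)"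
    and "laplacian H (xs @ ys) = four_block_mat A B C D"
  shows "A = laplacian H xs"
proof (rule eq_matI)
  fix i j assume "i < dim_row (laplacian H xs)" "j < dim_col (laplacian H xs)"
  then have "i < length xs" "j < length xs" by auto
  then show "A $$ (i, j) = laplacian H xs $$ (i, j)"
    using arg_cong[OF assms(3), of "\<lambda>M. M $$ (i, j)"] assms(1,2)
    by (simp add: laplacian_def nth_append)
qed (use assms in auto)

theorem theorem3p1:
  fixes G1 G2 Y :: "'v pair_pre_digraph"
    and G :: "('v + 'v) set pair_pre_digraph"
    and xs1 xs2 ys :: "'v list"
    and vs :: "('v + 'v) set list"
    and A1 B1 D1 A2 B2 D2 :: "real mat"
  assumes "pair_graph G1" and "Digraph_Component.connected (with_proj G1)"
    and "pair_graph G2" and "Digraph_Component.connected (with_proj G2)"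
    and "pair_graph Y" and "pverts Y \<noteq> {}"
    and "induced_subgraph (with_proj Y) (with_proj G1)"
    and "induced_subgraph (with_proj Y) (with_proj G2)"
    and "G = glue G1 Y G2"
    and "distinct xs1" and "set xs1 = pverts G1 - pverts Y"
    and "distinct xs2" and "set xs2 = pverts G2 - pverts Y"
    and "distinct ys" and "set ys = pverts Y"
    and "distinct vs" and "set vs = pverts G"
    and "A1 \<in> carrier_mat (length xs1) (length xs1)"
    and "B1 \<in> carrier_mat (length xs1) (length ys)"
    and "D1 \<in> carrier_mat (length ys) (length ys)"
    and "laplacian G1 (xs1 @ ys) = four_block_mat A1 B1 (transpose_mat B1) D1"
    and "A2 \<in> carrier_mat (length xs2) (length xs2)"
    and "B2 \<in> carrier_mat (length xs2) (length ys)"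
    and "D2 \<in> carrier_mat (length ys) (length ys)"
    and "laplacian G2 (xs2 @ ys) = four_block_mat A2 B2 (transpose_mat B2) D2"
  shows "pseudo_det (laplacian G vs) =
    complex_of_real (real (card (pverts G)) / real (card (pverts Y)) * det A1 * det A2)
      * pseudo_det (DN_glued G1 xs1 Y ys G2 xs2)"
proof -
  interpret gluing G1 G2 Y by (intro gluing.intro assms)
  have "A1 = laplacian G1 xs1" "A2 = laplacian G2 xs2"
    by (rule upper_left_block_laplacian; fact)+
  then show ?thesis
    using pseudo_det_laplacian_glue[of xs1 xs2 ys vs] assms by simp
qed

end
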